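(* Let $b$ be a positive integer. For every tree $T$, in the $b$-biased Maker-Breaker domination game on $T$ with Dominator as the first player, Dominator can ensure that at the end of the game at least $\left(1-\frac{1}{(b+1)^2}\right)v(T)$ vertices of $T$ are dominated by her (i.e. are claimed by her or have a neighbour claimed by her). Moreover, this bound is sharp: there are trees $T$ with arbitrarily many vertices on which Staller can ensure that at most $\left(1-\frac{1}{(b+1)^2}+o(1)\right)v(T)$ vertices are dominated by Dominator, where $o(1)\to 0$ as $v(T)\to\infty$.
   Context: The $b$-biased Maker-Breaker domination game on a finite graph $G$: Dominator and Staller alternately claim previously unclaimed vertices of $G$ until all vertices are claimed; in each of her turns Dominator claims up to $b$ vertices, in each of his turns Staller claims one vertex. A vertex is dominated by Dominator if it or one of its neighbours is claimed by Dominator. $v(T)$ is the number of vertices of $T$. *)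

theory Defs
  imports Complex_Main "Graph_Theory.Graph_Theory"
begin

text \<open>
  A finite simple graph is a \<^locale>\<open>pair_graph\<close>: a finite vertex set with a symmetric
  irreflexive set of arcs. The library predicate \<^const>\<open>tree\<close> cannot be used for such graphs:
  it counts the closed walk a, b, a as a cycle. In a simple graph the undirected cycles are
  the cycles of length at least 3.
\<close>

definition undirected_tree :: "'a pair_pre_digraph \<Rightarrow> bool" where
  "undirected_tree T \<longleftrightarrow>
     pair_graph T \<and> Digraph_Component.connected (with_proj T) \<and>
     \<not> (\<exists>p. pre_digraph.cycle (with_proj T) p \<and> length p \<ge> 3)"

datatype player = Dominator | Staller

text \<open>
  A history lists, in chronological order, the sets of vertices claimed in the turns played so
  far. Dominator moves first, hence owns the turns with even index.
\<close>

type_synonym 'a history = "'a set list"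

definition to_move :: "'a history \<Rightarrow> player" where
  "to_move h = (if even (length h) then Dominator else Staller)"

definition claimed :: "'a history \<Rightarrow> 'a set" where
  "claimed h = \<Union> (set h)"

definition claimed_by :: "player \<Rightarrow> 'a history \<Rightarrow> 'a set" where
  "claimed_by P h = \<Union> {h ! i | i. i < length h \<and> to_move (take i h) = P}"

definition game_over :: "'a pair_pre_digraph \<Rightarrow> 'a history \<Rightarrow> bool" where
  "game_over G h \<longleftrightarrow> claimed h = pverts G"

text \<open>Claiming up to b vertices is read literally: Dominator may claim fewer, even none.\<close>

definition legal_move :: "nat \<Rightarrow> 'a pair_pre_digraph \<Rightarrow> 'a history \<Rightarrow> 'a set \<Rightarrow> bool" where
  "legal_move b G h M \<longleftrightarrow>
     \<not> game_over G h \<and> M \<subseteq> pverts G - claimed h \<and>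
     (case to_move h of Dominator \<Rightarrow> card M \<le> b | Staller \<Rightarrow> card M = 1)"

inductive legal_history :: "nat \<Rightarrow> 'a pair_pre_digraph \<Rightarrow> 'a history \<Rightarrow> bool"
  for b :: nat and G :: "'a pair_pre_digraph" where
  start: "legal_history b G []"
| turn: "legal_history b G h \<Longrightarrow> legal_move b G h M \<Longrightarrow> legal_history b G (h @ [M])"

text \<open>
  A strategy must prescribe a legal move whenever its owner is to move; otherwise a player could
  ensure anything by blocking every play.
\<close>

definition strategy ::
  "nat \<Rightarrow> 'a pair_pre_digraph \<Rightarrow> player \<Rightarrow> ('a history \<Rightarrow> 'a set) \<Rightarrow> bool" where
  "strategy b G P \<sigma> \<longleftrightarrow>
     (\<forall>h. legal_history b G h \<and> \<not> game_over G h \<and> to_move h = P \<longrightarrow> legal_move b G h (\<sigma> h))"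

definition follows :: "player \<Rightarrow> ('a history \<Rightarrow> 'a set) \<Rightarrow> 'a history \<Rightarrow> bool" where
  "follows P \<sigma> h \<longleftrightarrow> (\<forall>i < length h. to_move (take i h) = P \<longrightarrow> h ! i = \<sigma> (take i h))"

definition dominated :: "'a pair_pre_digraph \<Rightarrow> 'a history \<Rightarrow> 'a set" where
  "dominated G h =
     {v \<in> pverts G. v \<in> claimed_by Dominator h \<or>
        (\<exists>u \<in> claimed_by Dominator h. (u, v) \<in> parcs G)}"

definition can_ensure ::
  "nat \<Rightarrow> 'a pair_pre_digraph \<Rightarrow> player \<Rightarrow> (nat \<Rightarrow> bool) \<Rightarrow> bool" where
  "can_ensure b G P Q \<longleftrightarrow>
     (\<exists>\<sigma>. strategy b G P \<sigma> \<and>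
        (\<forall>h. legal_history b G h \<and> game_over G h \<and> follows P \<sigma> h \<longrightarrow> Q (card (dominated G h))))"

end

theory Submission
  imports Defs
begin

text \<open>
  Lower bound: a vertex ends up undominated exactly when Staller claims its whole closed
  neighbourhood. As in the biased Erdos-Selfridge criterion, give a closed neighbourhood that
  Dominator has not touched and that has k unclaimed vertices the weight (b + 1)^(-k). If
  Dominator always claims the heaviest vertices, the total weight never increases over a round;
  at the end it counts the undominated vertices, and at the start it is at most n / (b + 1)^2,
  since in a tree with at least two vertices every closed neighbourhood has at least two elements.

  Sharpness: join the centres of b + 1 stars with m leaves each. Dominator's first turn misses
  some centre; Staller takes it and then a 1 / (b + 1) fraction of its leaves, up to a bounded
  error.
\<close>

section \<open>Histories\<close>

lemma claimed_snoc [simp]: "claimed (h @ [M]) = claimed h \<union> M"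
  by (auto simp: claimed_def)

lemma claimed_by_Nil [simp]: "claimed_by P [] = {}"
  by (simp add: claimed_by_def)

text \<open>Appending a turn leaves every earlier prefix, hence every earlier owner, unchanged. With
  \<open>follows_snoc\<close> this lets invariants be proved turn by turn.\<close>

lemma claimed_by_snoc [simp]:
  "claimed_by P (h @ [M]) = claimed_by P h \<union> (if to_move h = P then M else {})"
proof -
  have "claimed_by P (h @ [M]) =
      \<Union> {(h @ [M]) ! i | i. (i < length h \<or> i = length h) \<and> to_move (take i (h @ [M])) = P}"
    by (simp add: claimed_by_def less_Suc_eq)
  also have "\<dots> = \<Union> ({(h @ [M]) ! i | i. i < length h \<and> to_move (take i (h @ [M])) = P}
      \<union> {(h @ [M]) ! i | i. i = length h \<and> to_move (take i (h @ [M])) = P})"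
    by blast
  also have "{(h @ [M]) ! i | i. i < length h \<and> to_move (take i (h @ [M])) = P} =
      {h ! i | i. i < length h \<and> to_move (take i h) = P}"
    by (intro Collect_cong ex_cong1) (auto simp: nth_append)
  finally show ?thesis
    by (auto simp: claimed_by_def)
qed

lemma follows_snoc [simp]:
  "follows P \<sigma> (h @ [M]) \<longleftrightarrow> follows P \<sigma> h \<and> (to_move h = P \<longrightarrow> M = \<sigma> h)"
  by (auto simp: follows_def less_Suc_eq nth_append)

lemma claimed_eq: "claimed h = claimed_by Dominator h \<union> claimed_by Staller h"
proof (induction h rule: rev_induct)
  case Nil
  then show ?case by (simp add: claimed_def)
next
  case (snoc M h)
  then show ?case by (cases "to_move h") auto
qed

lemma claimed_subset_verts: "legal_history b G h \<Longrightarrow> claimed h \<subseteq> pverts G"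
  by (induction rule: legal_history.induct) (auto simp: claimed_def legal_move_def)

lemma claimed_by_disjoint:
  "legal_history b G h \<Longrightarrow> claimed_by Dominator h \<inter> claimed_by Staller h = {}"
proof (induction rule: legal_history.induct)
  case (turn h M)
  then have "M \<inter> claimed h = {}"
    by (auto simp: legal_move_def)
  with turn show ?case
    by (auto simp: claimed_eq)
qed simp


lemma can_ensureI:
  assumes "strategy b G P \<sigma>"
    and "\<And>h. legal_history b G h \<Longrightarrow> game_over G h \<Longrightarrow> follows P \<sigma> h \<Longrightarrow> Q (card (dominated G h))"
  shows "can_ensure b G P Q"
  using assms unfolding can_ensure_def by (intro exI[of _ \<sigma>]) simp

lemma can_ensure_mono:
  assumes "can_ensure b G P Q" "\<And>d. Q d \<Longrightarrow> R d"
  shows "can_ensure b G P R"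
  using assms unfolding can_ensure_def by meson


section \<open>The danger potential\<close>

text \<open>The sets form a family indexed by \<open>V\<close> because distinct vertices can share a
  closed neighbourhood and each must count. Once \<open>N v\<close> misses \<open>D\<close>, the
  members of \<open>N v - S\<close> are its unclaimed vertices.\<close>

definition danger :: "nat \<Rightarrow> 'v set \<Rightarrow> ('v \<Rightarrow> 'a set) \<Rightarrow> 'a set \<Rightarrow> 'a set \<Rightarrow> real" where
  "danger b V N D S = (\<Sum>v | v \<in> V \<and> N v \<inter> D = {}. (1 / (real b + 1)) ^ card (N v - S))"

text \<open>The part of the danger carried by sets through \<open>x\<close>: what Dominator removes
  by claiming \<open>x\<close> and, up to the factor b, what Staller adds by claiming it.\<close>

definition danger_at :: "nat \<Rightarrow> 'v set \<Rightarrow> ('v \<Rightarrow> 'a set) \<Rightarrow> 'a set \<Rightarrow> 'a set \<Rightarrow> 'a \<Rightarrow> real" where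
  "danger_at b V N D S x =
     (\<Sum>v | v \<in> V \<and> N v \<inter> D = {} \<and> x \<in> N v. (1 / (real b + 1)) ^ card (N v - S))"

lemma danger_at_nonneg: "danger_at b V N D S x \<ge> 0"
  unfolding danger_at_def by (intro sum_nonneg) simp

lemma danger_at_mono:
  assumes "finite V" "D \<subseteq> D'"
  shows "danger_at b V N D' S x \<le> danger_at b V N D S x"
  unfolding danger_at_def using assms by (intro sum_mono2) auto

lemma danger_insert_Dominator:
  assumes "finite V"
  shows "danger b V N (insert x D) S = danger b V N D S - danger_at b V N D S x"
proof -
  have "{v \<in> V. N v \<inter> D = {}} =
      {v \<in> V. N v \<inter> insert x D = {}} \<union> {v \<in> V. N v \<inter> D = {} \<and> x \<in> N v}"
    by auto
  then have "danger b V N D S = danger b V N (insert x D) S + danger_at b V N D S x"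
    unfolding danger_def danger_at_def
    using assms by (simp only:) (intro sum.union_disjoint, auto)
  then show ?thesis by simp
qed

text \<open>Each untouched set through \<open>x\<close> loses one unclaimed vertex, so its weight is
  multiplied by b + 1, a gain of b times the old weight. With this base, b claims of Dominator can
  offset one of Staller.\<close>

lemma danger_insert_Staller:
  assumes "finite V" "\<And>v. v \<in> V \<Longrightarrow> finite (N v)" "x \<notin> S"
  shows "danger b V N D (insert x S) = danger b V N D S + b * danger_at b V N D S x"
proof -
  let ?q = "1 / (real b + 1)"
  have eq: "?q ^ card (N v - insert x S) =
      ?q ^ card (N v - S) + (if x \<in> N v then b * ?q ^ card (N v - S) else 0)" if "v \<in> V" for v
  proof (cases "x \<in> N v")
    case True
    then have "card (N v - S) = Suc (card (N v - insert x S))"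
      using assms that by (metis Diff_iff Diff_insert card.remove finite_Diff)
    then have "?q ^ card (N v - insert x S) = (real b + 1) * ?q ^ card (N v - S)"
      by simp
    with True show ?thesis
      by (simp add: algebra_simps)
  next
    case False
    then have "N v - insert x S = N v - S" by auto
    with False show ?thesis by simp
  qed
  have "danger b V N D (insert x S) = (\<Sum>v | v \<in> V \<and> N v \<inter> D = {}.
      ?q ^ card (N v - S) + (if x \<in> N v then b * ?q ^ card (N v - S) else 0))"
    unfolding danger_def by (intro sum.cong) (auto simp: eq)
  also have "\<dots> = danger b V N D S +
      (\<Sum>v | v \<in> V \<and> N v \<inter> D = {}. if x \<in> N v then b * ?q ^ card (N v - S) else 0)"
    by (simp add: sum.distrib danger_def)
  also have "(\<Sum>v | v \<in> V \<and> N v \<inter> D = {}. if x \<in> N v then b * ?q ^ card (N v - S) else 0) =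
      (\<Sum>v | v \<in> V \<and> N v \<inter> D = {} \<and> x \<in> N v. b * ?q ^ card (N v - S))"
    using assms(1) by (intro sum.mono_neutral_cong_right) auto
  finally show ?thesis
    by (simp add: danger_at_def sum_distrib_left)
qed

text \<open>
  The greedy answer: each of the k vertices is the most dangerous one left, so together they
  outweigh k times any vertex that remains.
\<close>

lemma greedy_claim:
  assumes "finite V" "finite F"
  shows "\<exists>M \<subseteq> F. card M \<le> k \<and> danger b V N (D \<union> M) S \<le> danger b V N D S \<and>
    (\<forall>y \<in> F - M. danger b V N (D \<union> M) S + k * danger_at b V N (D \<union> M) S y
       \<le> danger b V N D S)"
proof (induction k)
  case 0
  then show ?case by (intro exI[of _ "{}"]) auto
next
  case (Suc k)
  then obtain M where M: "M \<subseteq> F" "card M \<le> k" "danger b V N (D \<union> M) S \<le> danger b V N D S"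
    and rest: "\<And>y. y \<in> F - M \<Longrightarrow>
      danger b V N (D \<union> M) S + k * danger_at b V N (D \<union> M) S y \<le> danger b V N D S"
    by blast
  show ?case
  proof (cases "F - M = {}")
    \<comment> \<open>Nothing is left to claim, so the condition on the remaining vertices is
      vacuous and \<open>M\<close> may stay smaller than \<open>Suc k\<close>.\<close>
    case True
    with M show ?thesis by (intro exI[of _ M]) simp_all
  next
    case False
    let ?w = "danger_at b V N (D \<union> M) S"
    have fin: "finite (?w ` (F - M))" using assms(2) by simp
    then have "Max (?w ` (F - M)) \<in> ?w ` (F - M)"
      using False by (intro Max_in) auto
    then obtain x where x: "x \<in> F - M" and "?w x = Max (?w ` (F - M))"
      by force
    then have max: "?w y \<le> ?w x" if "y \<in> F - M" for y
      using fin that by simp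
    have drop: "danger b V N (D \<union> insert x M) S = danger b V N (D \<union> M) S - ?w x"
      using danger_insert_Dominator[OF assms(1), where D = "D \<union> M"] by simp
    \<comment> \<open>Claiming \<open>x\<close> lowers the danger by \<open>?w x\<close>, which pays
      for one of the \<open>Suc k\<close> copies of the danger at \<open>y\<close>; the induction
      hypothesis at \<open>x\<close> pays for the other k.\<close>
    have "danger b V N (D \<union> insert x M) S +
        Suc k * danger_at b V N (D \<union> insert x M) S y \<le> danger b V N D S"
      if "y \<in> F - insert x M" for y
    proof -
      have "danger_at b V N (D \<union> insert x M) S y \<le> ?w y"
        using assms(1) by (intro danger_at_mono) auto
      also have "?w y \<le> ?w x"
        using that max by blast
      finally have "Suc k * danger_at b V N (D \<union> insert x M) S y \<le> Suc k * ?w x"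
        by (intro mult_left_mono) auto
      with rest[OF x] drop show ?thesis
        by (simp add: algebra_simps)
    qed
    moreover have "card (insert x M) \<le> Suc k"
      using M(2) card_insert_le_m1[of "Suc k" M x] by simp
    moreover have "danger b V N (D \<union> insert x M) S \<le> danger b V N D S"
      using drop M(3) danger_at_nonneg[of b V N "D \<union> M" S x] by linarith
    ultimately show ?thesis
      using M(1) x by (intro exI[of _ "insert x M"]) auto
  qed
qed

section \<open>Closed neighbourhoods and Dominator's greedy strategy\<close>

definition closed_nbhd :: "'a pair_pre_digraph \<Rightarrow> 'a \<Rightarrow> 'a set" where
  "closed_nbhd G v = insert v {u. (u, v) \<in> parcs G}"

lemma closed_nbhd_subset:
  assumes "pair_graph G" "v \<in> pverts G"
  shows "closed_nbhd G v \<subseteq> pverts G"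
proof -
  interpret pair_graph G by fact
  show ?thesis using assms(2) by (auto simp: closed_nbhd_def dest: in_arcsD1)
qed

lemma finite_closed_nbhd:
  assumes "pair_graph G" "v \<in> pverts G"
  shows "finite (closed_nbhd G v)"
proof -
  interpret pair_graph G by fact
  show ?thesis using closed_nbhd_subset[OF assms] pair_finite_verts finite_subset by blast
qed

lemma dominated_iff:
  "v \<in> dominated G h \<longleftrightarrow> v \<in> pverts G \<and> closed_nbhd G v \<inter> claimed_by Dominator h \<noteq> {}"
  by (auto simp: dominated_def closed_nbhd_def)

theorem Dominator_ensures_danger:
  assumes "pair_graph G"
  shows "can_ensure b G Dominator
    (\<lambda>d. real d \<ge> card (pverts G) - danger b (pverts G) (closed_nbhd G) {} {})"
proof -
  interpret pair_graph G by fact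
  let ?\<Phi> = "danger b (pverts G) (closed_nbhd G)"
  let ?w = "danger_at b (pverts G) (closed_nbhd G)"
  let ?D = "claimed_by Dominator" and ?S = "claimed_by Staller"
  \<comment> \<open>\<open>good\<close> is stated for every history, whoever is to move, so
    \<open>greedy_claim\<close> always backs the choice by \<open>SOME\<close>.\<close>
  define good where "good h M \<longleftrightarrow> M \<subseteq> pverts G - claimed h \<and> card M \<le> b \<and>
      (let D = ?D h; S = ?S h in
        ?\<Phi> (D \<union> M) S \<le> ?\<Phi> D S \<and>
        (\<forall>y \<in> pverts G - claimed h - M. ?\<Phi> (D \<union> M) S + b * ?w (D \<union> M) S y \<le> ?\<Phi> D S))"
    for h M
  define \<sigma> where "\<sigma> h = (SOME M. good h M)" for h
  have good: "good h (\<sigma> h)" for h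
    unfolding \<sigma>_def
  proof (rule someI_ex)
    show "\<exists>M. good h M"
      unfolding good_def Let_def using pair_finite_verts by (intro greedy_claim) auto
  qed
  have strat: "strategy b G Dominator \<sigma>"
    using good by (auto simp: strategy_def legal_move_def good_def)
  \<comment> \<open>After Dominator's turn the stronger clause reserves room for the increase caused
    by any Staller reply. After the reply only the plain bound is left, and the next greedy turn
    restores the clause.\<close>
  have inv: "?\<Phi> (?D h) (?S h) \<le> ?\<Phi> {} {} \<and> (to_move h = Staller \<longrightarrow>
      (\<forall>y \<in> pverts G - claimed h. ?\<Phi> (?D h) (?S h) + b * ?w (?D h) (?S h) y \<le> ?\<Phi> {} {}))"
    if "legal_history b G h" "follows Dominator \<sigma> h" for h
    using that
  proof (induction rule: legal_history.induct)
    case start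
    then show ?case by (simp add: to_move_def)
  next
    case (turn h M)
    show ?case
    proof (cases "to_move h")
      case Dominator
      then have "to_move (h @ [M]) = Staller" "M = \<sigma> h"
        using turn.prems by (auto simp: to_move_def split: if_splits)
      moreover have "?\<Phi> (?D h \<union> M) (?S h) \<le> ?\<Phi> (?D h) (?S h)"
        and "\<forall>y \<in> pverts G - claimed h - M.
          ?\<Phi> (?D h \<union> M) (?S h) + b * ?w (?D h \<union> M) (?S h) y \<le> ?\<Phi> (?D h) (?S h)"
        using good[of h] \<open>M = \<sigma> h\<close> by (simp_all add: good_def Let_def)
      moreover have "?\<Phi> (?D h) (?S h) \<le> ?\<Phi> {} {}"
        using turn Dominator by simp
      ultimately have "?\<Phi> (?D h \<union> M) (?S h) \<le> ?\<Phi> {} {}"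
        and "\<forall>y \<in> pverts G - claimed h - M.
          ?\<Phi> (?D h \<union> M) (?S h) + b * ?w (?D h \<union> M) (?S h) y \<le> ?\<Phi> {} {}"
        by (blast intro: order_trans)+
      with Dominator show ?thesis
        by simp
    next
      case Staller
      then obtain y where y: "M = {y}" "y \<in> pverts G - claimed h"
        using turn.hyps(2) by (auto simp: legal_move_def card_1_singleton_iff)
      have "to_move (h @ [M]) = Dominator"
        using Staller by (auto simp: to_move_def split: if_splits)
      moreover have "y \<notin> ?S h"
        using y(2) by (simp add: claimed_eq)
      then have "?\<Phi> (?D h) (insert y (?S h)) = ?\<Phi> (?D h) (?S h) + b * ?w (?D h) (?S h) y"
        using pair_finite_verts finite_closed_nbhd[OF assms] by (intro danger_insert_Staller)
      moreover have "?\<Phi> (?D h) (?S h) + b * ?w (?D h) (?S h) y \<le> ?\<Phi> {} {}"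
        using turn.IH turn.prems y(2) Staller by simp
      ultimately show ?thesis
        using Staller y(1) by simp
    qed
  qed
  have outcome: "real (card (dominated G h)) \<ge> card (pverts G) - ?\<Phi> {} {}"
    if h: "legal_history b G h" "game_over G h" "follows Dominator \<sigma> h" for h
  proof -
    let ?U = "{v \<in> pverts G. closed_nbhd G v \<inter> ?D h = {}}"
    \<comment> \<open>When all vertices are claimed, a closed neighbourhood missed by Dominator
      belongs to Staller and has weight 1, so the danger counts the undominated vertices.\<close>
    have "closed_nbhd G v - ?S h = {}" if "v \<in> ?U" for v
      using that closed_nbhd_subset[OF assms, of v] h(2) claimed_eq[of h]
      by (auto simp: game_over_def)
    then have "?\<Phi> (?D h) (?S h) = (\<Sum>v\<in>?U. 1)"
      unfolding danger_def by (intro sum.cong refl) (simp only: card.empty power_0)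
    then have "real (card ?U) \<le> ?\<Phi> {} {}"
      using inv[OF h(1,3)] by simp
    moreover have "card (pverts G) = card (dominated G h \<union> ?U)"
      by (rule arg_cong[where f = card]) (auto simp: dominated_iff)
    then have "card (pverts G) \<le> card (dominated G h) + card ?U"
      by (simp only: card_Un_le)
    ultimately show ?thesis by linarith
  qed
  show ?thesis
    by (rule can_ensureI[OF strat]) (rule outcome)
qed

section \<open>The lower bound on trees\<close>

text \<open>Connectedness gives a walk to \<open>v\<close> from another vertex; the tail of its last
  arc is a neighbour of \<open>v\<close>.\<close>

lemma card_closed_nbhd:
  assumes "undirected_tree T" "v \<in> pverts T" "card (pverts T) \<noteq> 1"
  shows "card (closed_nbhd T v) \<ge> 2"
proof -
  interpret pair_graph T using assms(1) by (simp add: undirected_tree_def)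
  have "pverts T \<noteq> {v}" using assms(3) by auto
  then obtain u where u: "u \<in> pverts T" "u \<noteq> v" using assms(2) by blast
  have "Digraph_Component.connected (with_proj T)"
    using assms(1) by (simp add: undirected_tree_def)
  \<comment> \<open>Connectedness speaks of the symmetric closure, which has the same reachability
    here because the arcs are already symmetric.\<close>
  then have "u \<rightarrow>\<^sup>*\<^bsub>with_proj (mk_symmetric (with_proj T))\<^esub> v"
    using u assms(2) by (auto simp: Digraph_Component.connected_def strongly_connected_def
        mk_symmetric_def)
  then have "u \<rightarrow>\<^sup>*\<^bsub>with_proj T\<^esub> v"
    by (simp add: reachable_mk_symmetric_eq[OF sym_arcs])
  then obtain w where "(w, v) \<in> parcs T"
    using u(2) by (metis reachable_neq_reachable1 tranclE with_proj_simps(3))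
  moreover from this have "w \<noteq> v"
    using pair_no_loops by fastforce
  ultimately have "{v, w} \<subseteq> closed_nbhd T v" "card {v, w} = 2"
    by (auto simp: closed_nbhd_def)
  then show ?thesis
    using finite_closed_nbhd[of T v] assms(1,2)
    by (metis card_mono undirected_tree_def)
qed

theorem Dominator_on_trees:
  assumes "b > 0" "undirected_tree T"
  shows "can_ensure b T Dominator
    (\<lambda>d. real d \<ge> (1 - 1 / (real b + 1)^2) * real (card (pverts T)))"
proof -
  interpret pair_graph T using assms(2) by (simp add: undirected_tree_def)
  let ?n = "card (pverts T)" and ?q = "1 / (real b + 1)"
  let ?\<Phi> = "danger b (pverts T) (closed_nbhd T) {} {}"
  have "(1 - 1 / (real b + 1)^2) * ?n \<le> d" if d: "real ?n - ?\<Phi> \<le> real d" for d :: nat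
  proof (cases "?n = 1")
    case True
    then obtain v where v: "pverts T = {v}" by (auto simp: card_1_singleton_iff)
    then have "closed_nbhd T v = {v}"
      using closed_nbhd_subset[of T v] assms(2) by (auto simp: undirected_tree_def closed_nbhd_def)
    with v have "?\<Phi> = ?q"
      by (simp add: danger_def)
    also have "?q < 1"
      using assms(1) by simp
    \<comment> \<open>The potential alone is too weak here; integrality of \<open>d\<close> gains the difference.\<close>
    finally have "d \<ge> 1"
      using d True by (cases d) auto
    then have "(1 - 1 / (real b + 1)^2) * ?n \<le> 1"
      using True by simp
    with \<open>d \<ge> 1\<close> show ?thesis by linarith
  next
    case False
    \<comment> \<open>Every exponent is at least 2 and \<open>?q\<close> is at most 1, so each
      vertex contributes at most \<open>?q ^ 2\<close>.\<close>
    have "?\<Phi> \<le> (\<Sum>v\<in>pverts T. ?q ^ 2)"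
      unfolding danger_def using card_closed_nbhd[OF assms(2) _ False]
      by (simp del: sum_constant) (intro sum_mono power_decreasing, auto)
    also have "\<dots> = ?n / (real b + 1)^2"
      by (simp add: power_divide)
    finally show ?thesis
      using d by (simp add: algebra_simps)
  qed
  then show ?thesis
    by (rule can_ensure_mono[OF Dominator_ensures_danger[OF pair_graph_axioms]])
qed


section \<open>Trees given by a parent function\<close>

text \<open>Vertex 0 is the root, so edges come from the positive vertices only. Each edge is
  entered in both directions to make the arcs symmetric. The graph is a tree once it has a vertex
  and parents are smaller than their children.\<close>

definition parent_graph :: "nat \<Rightarrow> (nat \<Rightarrow> nat) \<Rightarrow> nat pair_pre_digraph" where
  "parent_graph n f = \<lparr> pverts = {..<n},
     parcs = (\<lambda>i. (i, f i)) ` {0<..<n} \<union> (\<lambda>i. (f i, i)) ` {0<..<n} \<rparr>"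

lemma parcs_parent_graph:
  "(u, v) \<in> parcs (parent_graph n f) \<longleftrightarrow>
    (0 < u \<and> u < n \<and> v = f u) \<or> (0 < v \<and> v < n \<and> u = f v)"
  by (auto simp: parent_graph_def)

lemma pverts_parent_graph [simp]: "pverts (parent_graph n f) = {..<n}"
  by (simp add: parent_graph_def)

context
  fixes n :: nat and f :: "nat \<Rightarrow> nat"
  assumes f_less: "\<And>i. 0 < i \<Longrightarrow> f i < i"
begin

lemma pair_graph_parent_graph: "pair_graph (parent_graph n f)"
proof
  show "finite (parcs (parent_graph n f))"
    by (simp add: parent_graph_def)
  show "symmetric (with_proj (parent_graph n f))"
    by (auto simp: symmetric_def parcs_parent_graph intro!: symI)
next
  fix e assume "e \<in> parcs (parent_graph n f)"
  then show "fst e \<in> pverts (parent_graph n f)" "snd e \<in> pverts (parent_graph n f)" "fst e \<noteq> snd e"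
    by (cases e; fastforce simp: parcs_parent_graph dest: f_less)+
qed simp

text \<open>Passing to the parent strictly decreases the vertex, so every vertex reaches 0; by
  symmetry 0 reaches every vertex.\<close>

lemma connected_parent_graph:
  assumes "n > 0"
  shows "Digraph_Component.connected (with_proj (parent_graph n f))"
proof -
  interpret pair_graph "parent_graph n f" by (rule pair_graph_parent_graph)
  have root: "i \<rightarrow>\<^sup>*\<^bsub>with_proj (parent_graph n f)\<^esub> 0" if "i < n" for i
    using that
  proof (induction i rule: less_induct)
    case (less i)
    show ?case
    proof (cases "i = 0")
      case True
      then show ?thesis using assms by (auto intro: reachable_refl)
    next
      case False
      then have "(i, f i) \<in> parcs (parent_graph n f)"
        using less.prems by (simp add: parcs_parent_graph)
      moreover have "f i \<rightarrow>\<^sup>*\<^bsub>with_proj (parent_graph n f)\<^esub> 0"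
        using less f_less[of i] False by simp
      ultimately show ?thesis
        by (metis adj_reachable_trans with_proj_simps(3))
    qed
  qed
  have "i \<rightarrow>\<^sup>*\<^bsub>with_proj (parent_graph n f)\<^esub> j" if "i < n" "j < n" for i j
    using root[OF that(1)] root[OF that(2)] symmetric_reachable'[of j 0] reachable_trans by blast
  then have "strongly_connected (with_proj (parent_graph n f))"
    using assms by (auto simp: strongly_connected_def)
  then show ?thesis
    using reachable_mk_symmetric_eq[OF sym_arcs]
    by (auto simp: Digraph_Component.connected_def strongly_connected_def mk_symmetric_def)
qed

lemma parent_arc_cases:
  assumes "(u, v) \<in> parcs (parent_graph n f)"
  shows "v < u \<and> v = f u \<or> u < v \<and> u = f v"
  using assms f_less[of u] f_less[of v] by (auto simp: parcs_parent_graph)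

text \<open>Both neighbours of the largest vertex on a cycle would have to be its parent.\<close>

lemma no_cycle_parent_graph:
  assumes "pre_digraph.cycle (with_proj (parent_graph n f)) p"
  shows "length p < 3"
proof (rule ccontr)
  assume "\<not> length p < 3"
  then have len: "length p \<ge> 3" by simp
  interpret pair_graph "parent_graph n f" by (rule pair_graph_parent_graph)
  obtain u where walk: "awalk u p u" and dist: "distinct (tl (pawalk_verts u p))"
    using assms unfolding cycle_def by blast
  have cas: "pcas u p u" and arcs: "set p \<subseteq> parcs (parent_graph n f)"
    using walk by (auto simp: awalk_def)
  let ?L = "length p"
  \<comment> \<open>The heads of the arcs in cyclic order; the index modulo \<open>?L\<close> treats
    the closing arc like all others.\<close>
  let ?x = "\<lambda>i. snd (p ! (i mod ?L))"
  have "p \<noteq> []" using len by auto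
  then have L: "?L > 0" by simp
  have "pawalk_verts u p = fst (hd p) # map snd p"
    using awalk_verts_conv'[OF cas] \<open>p \<noteq> []\<close> by simp
  \<comment> \<open>\<open>tl\<close> drops the start vertex, which the closed walk repeats at its
    end. What remains are the heads of the arcs, so these are distinct.\<close>
  with dist have inj: "?x i = ?x j \<longleftrightarrow> i mod ?L = j mod ?L" for i j
    using L nth_eq_iff_index_eq[of "map snd p" "i mod ?L" "j mod ?L"] by simp
  have step: "pcas v q w \<Longrightarrow> i < length q \<Longrightarrow> fst (q ! i) = (if i = 0 then v else snd (q ! (i - 1)))"
    for v q w i
    by (induction v q w arbitrary: i rule: pcas.induct) (auto simp: nth_Cons' split: if_splits)
  have last: "pcas v q w \<Longrightarrow> q \<noteq> [] \<Longrightarrow> snd (last q) = w" for v q w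
    by (induction v q w rule: pcas.induct) auto
  have "(?x i, ?x (Suc i)) \<in> parcs (parent_graph n f)" for i
  proof -
    have "fst (p ! (Suc i mod ?L)) = ?x i"
    proof (cases "Suc (i mod ?L) = ?L")
      case True
      then have 0: "Suc i mod ?L = 0" and 1: "i mod ?L = ?L - 1"
        by (simp add: mod_Suc, linarith)
      have "fst (p ! 0) = u" "snd (p ! (?L - 1)) = u"
        using step[OF cas, of 0] last[OF cas \<open>p \<noteq> []\<close>] L by (simp_all add: last_conv_nth)
      then show ?thesis
        unfolding 0 1 by simp
    next
      case False
      then have "Suc i mod ?L = Suc (i mod ?L)" by (simp add: mod_Suc)
      moreover have "Suc (i mod ?L) < ?L"
        using False mod_less_divisor[OF L, of i] by linarith
      ultimately show ?thesis
        using step[OF cas, of "Suc (i mod ?L)"] by simp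
    qed
    moreover have "p ! (Suc i mod ?L) \<in> parcs (parent_graph n f)"
      using arcs nth_mem[OF mod_less_divisor[OF L]] by blast
    ultimately show ?thesis
      using prod.collapse[of "p ! (Suc i mod ?L)"] by simp
  qed
  then have arc: "?x (Suc i) < ?x i \<and> ?x (Suc i) = f (?x i) \<or>
      ?x i < ?x (Suc i) \<and> ?x i = f (?x (Suc i))" for i
    by (rule parent_arc_cases)
  obtain k where k: "k < ?L" and max: "\<And>i. ?x i \<le> ?x k"
  proof -
    let ?X = "(\<lambda>i. snd (p ! i)) ` {..<?L}"
    have "Max ?X \<in> ?X" using L by (intro Max_in) auto
    then obtain k where "k < ?L" "snd (p ! k) = Max ?X" by auto
    moreover have "?x i \<le> Max ?X" for i
      using L by (intro Max_ge) auto
    ultimately show ?thesis using that[of k] by simp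
  qed
  \<comment> \<open>The cyclic predecessor of \<open>k\<close>; adding \<open>?L\<close> keeps the
    natural subtraction from truncating when \<open>k\<close> is 0.\<close>
  define j where "j = k + ?L - 1"
  have "Suc j mod ?L = k mod ?L"
    using L by (simp add: j_def)
  then have "?x j \<le> ?x (Suc j)" "?x (Suc (Suc j)) \<le> ?x (Suc j)"
    using max[of j] max[of "Suc (Suc j)"] by simp_all
  then have "?x j = ?x (Suc (Suc j))"
    using arc[of j] arc[of "Suc j"] leD by metis
  \<comment> \<open>Heads two places apart agree only if the length divides 2, which is where length
    at least 3 enters.\<close>
  then have "j mod ?L = (j + 2) mod ?L"
    by (simp add: inj)
  then have "?L dvd 2"
    using mod_eq_dvd_iff_nat[of j "j + 2" ?L] by simp
  with len show False
    by (auto dest: dvd_imp_le)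
qed

lemma undirected_tree_parent_graph: "n > 0 \<Longrightarrow> undirected_tree (parent_graph n f)"
  unfolding undirected_tree_def
  using pair_graph_parent_graph connected_parent_graph no_cycle_parent_graph leD by blast

end

section \<open>Stars joined at their centres\<close>

text \<open>Vertices 0 to b are the centres, with all others among them joined to 0; each i > b is a
  leaf at centre i mod (b + 1). Every residue class consists of one centre and its m leaves.\<close>

definition joined_stars :: "nat \<Rightarrow> nat \<Rightarrow> nat pair_pre_digraph" where
  "joined_stars b m =
     parent_graph ((b + 1) * (m + 1)) (\<lambda>i. if i \<le> b then 0 else i mod (b + 1))"

definition star_leaves :: "nat \<Rightarrow> nat \<Rightarrow> nat \<Rightarrow> nat set" where
  "star_leaves b m c = {i. b < i \<and> i < (b + 1) * (m + 1) \<and> i mod (b + 1) = c}"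

lemma undirected_tree_joined_stars: "undirected_tree (joined_stars b m)"
  unfolding joined_stars_def
proof (rule undirected_tree_parent_graph)
  fix i :: nat assume "0 < i"
  have "i mod (b + 1) < b + 1" by (rule mod_less_divisor) simp
  then have "\<not> i \<le> b \<Longrightarrow> i mod (b + 1) < i" by linarith
  with \<open>0 < i\<close> show "(if i \<le> b then 0 else i mod (b + 1)) < i"
    by simp
qed simp

lemma pverts_joined_stars [simp]: "pverts (joined_stars b m) = {..<(b + 1) * (m + 1)}"
  by (simp add: joined_stars_def)

lemma finite_star_leaves: "finite (star_leaves b m c)"
  unfolding star_leaves_def by (rule finite_subset[of _ "{..<(b + 1) * (m + 1)}"]) auto

text \<open>The residue class of \<open>c\<close> consists of c + (b + 1) * k for k up to m. The
  value k = 0 gives the centre itself, hence the shift \<open>j + 1\<close>.\<close>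

lemma card_star_leaves:
  assumes "c \<le> b"
  shows "card (star_leaves b m c) = m"
proof -
  have "star_leaves b m c = (\<lambda>j. c + (b + 1) * (j + 1)) ` {..<m}"
  proof (intro equalityI subsetI)
    fix i assume i: "i \<in> star_leaves b m c"
    define k where "k = i div (b + 1)"
    have ik: "i = c + (b + 1) * k"
      using i mod_mult_div_eq[of i "b + 1"] by (simp add: star_leaves_def k_def)
    have "k \<noteq> 0"
      using ik i assms by (cases k) (auto simp: star_leaves_def)
    moreover have "(b + 1) * k < (b + 1) * (m + 1)"
      using ik i by (simp add: star_leaves_def)
    then have "k < m + 1"
      by (simp only: mult_less_cancel1)
    ultimately show "i \<in> (\<lambda>j. c + (b + 1) * (j + 1)) ` {..<m}"
      using ik by (intro image_eqI[of _ _ "k - 1"]) auto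
  next
    fix i assume "i \<in> (\<lambda>j. c + (b + 1) * (j + 1)) ` {..<m}"
    then obtain j where j: "j < m" "i = c + (b + 1) * (j + 1)" by auto
    have "(b + 1) * (j + 2) \<le> (b + 1) * (m + 1)"
      using j(1) by (intro mult_le_mono2) simp
    moreover have "i mod (b + 1) = c"
      using assms unfolding j(2) by (simp only: mod_mult_self2) simp
    ultimately show "i \<in> star_leaves b m c"
      using assms j(2) by (simp add: star_leaves_def)
  qed
  moreover have "inj_on (\<lambda>j. c + (b + 1) * (j + 1)) {..<m}"
  proof (rule inj_onI)
    fix x y assume "c + (b + 1) * (x + 1) = c + (b + 1) * (y + 1)"
    then have "x + 1 = y + 1 \<or> b + 1 = 0"
      by (simp only: add_left_cancel mult_cancel1)
    then show "x = y" by simp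
  qed
  ultimately show ?thesis
    by (simp add: card_image)
qed

text \<open>Every parent is at most b and every leaf exceeds b, so a leaf is nobody's parent and is
  joined only to its own centre.\<close>

lemma leaf_neighbour:
  assumes "i \<in> star_leaves b m c" "(u, i) \<in> parcs (joined_stars b m)"
  shows "u = c"
proof -
  have "u mod (b + 1) < b + 1" by (rule mod_less_divisor) simp
  also have "b + 1 \<le> i" using assms(1) by (simp add: star_leaves_def)
  finally have "i \<noteq> u mod (b + 1)" by simp
  with assms show ?thesis
    by (auto simp: star_leaves_def joined_stars_def parcs_parent_graph split: if_splits)
qed

section \<open>Staller's strategy on the joined stars\<close>

text \<open>\<open>s\<close> counts Staller's leaves in the star whose centre he owns. Such a leaf
  and its only neighbour are both his, so it is undominated. The term 2 * b allows for two Dominator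
  turns not matched by a Staller leaf: one answered by the centre and one still unanswered when the
  star is full.\<close>

lemma Staller_on_joined_stars:
  "can_ensure b (joined_stars b m) Staller
     (\<lambda>d. \<exists>s. d + s \<le> (b + 1) * (m + 1) \<and> m \<le> (b + 1) * s + 2 * b)"
proof -
  let ?T = "joined_stars b m" and ?D = "claimed_by Dominator" and ?S = "claimed_by Staller"
  \<comment> \<open>The choice depends on the first turn alone, so it never changes afterwards. It
    exists because b + 1 centres face at most b claims.\<close>
  define ctr :: "nat set list \<Rightarrow> nat" where "ctr h = (SOME c. c \<le> b \<and> c \<notin> h ! 0)" for h
  define L where "L h = star_leaves b m (ctr h)" for h
  \<comment> \<open>The centre comes first, then the leaves of its star; the last branch keeps the
    strategy legal once these are exhausted.\<close>
  define target where "target h =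
     (if ctr h \<notin> claimed h then {ctr h}
      else if L h - claimed h \<noteq> {} then L h - claimed h
      else pverts ?T - claimed h)" for h
  define \<sigma> where "\<sigma> h = {SOME v. v \<in> target h}" for h
  \<comment> \<open>\<open>card M \<le> b\<close> also holds for infinite \<open>M\<close>, whose
    \<open>card\<close> is 0, so finiteness has to come from the vertex set.\<close>
  have finite_move: "finite M" if "M \<subseteq> {..<(b + 1) * (m + 1)} - A" for M A
    using that by (rule finite_subset) simp
  have ctr: "ctr h \<le> b" "ctr h \<notin> h ! 0" if "card (h ! 0) \<le> b" "finite (h ! 0)" for h
  proof -
    have "\<not> {..b} \<subseteq> h ! 0"
      using that card_mono[of "h ! 0" "{..b}"] by auto
    then have "\<exists>c. c \<le> b \<and> c \<notin> h ! 0" by auto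
    then have "ctr h \<le> b \<and> ctr h \<notin> h ! 0"
      unfolding ctr_def by (rule someI_ex)
    then show "ctr h \<le> b" "ctr h \<notin> h ! 0" by auto
  qed
  have first: "card (h ! 0) \<le> b \<and> finite (h ! 0)"
    if "legal_history b ?T h" "h \<noteq> []" for h
    using that
  proof (induction rule: legal_history.induct)
    case (turn h M)
    show ?case
    proof (cases "h = []")
      case True
      with turn.hyps(2) True show ?thesis
        using finite_move[of M "claimed h"] by (auto simp: legal_move_def to_move_def)
    next
      case False
      with turn show ?thesis by (simp add: nth_append)
    qed
  qed simp
  have ctr_snoc: "ctr (h @ [M]) = ctr h" if "h \<noteq> []" for h M
    using that by (simp add: ctr_def nth_append)
  have L_verts: "L h \<subseteq> pverts ?T" for h
    by (auto simp: L_def star_leaves_def)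
  have \<sigma>: "\<exists>v. \<sigma> h = {v} \<and> v \<in> target h \<and> v \<in> pverts ?T - claimed h"
    if h: "legal_history b ?T h" "\<not> game_over ?T h" "h \<noteq> []" for h
  proof -
    have "ctr h \<in> pverts ?T"
      using ctr(1)[of h] first[OF h(1,3)] by simp
    then have "target h \<subseteq> pverts ?T - claimed h"
      using L_verts by (auto simp: target_def)
    moreover have "pverts ?T - claimed h \<noteq> {}"
      using h(2) claimed_subset_verts[OF h(1)] by (auto simp: game_over_def)
    then have "target h \<noteq> {}"
      by (auto simp: target_def)
    then have "(SOME v. v \<in> target h) \<in> target h"
      by (simp add: some_in_eq)
    ultimately show ?thesis
      unfolding \<sigma>_def by blast
  qed
  have strat: "strategy b ?T Staller \<sigma>"
    unfolding strategy_def
  proof (intro allI impI)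
    fix h assume h: "legal_history b ?T h \<and> \<not> game_over ?T h \<and> to_move h = Staller"
    then have "h \<noteq> []" by (auto simp: to_move_def)
    with h \<sigma>[of h] show "legal_move b ?T h (\<sigma> h)"
      by (auto simp: legal_move_def)
  qed
  \<comment> \<open>In the refined bound each Staller leaf pays for one Dominator turn, odd length
    allows for a turn not yet answered, and length at least 2 for the turn answered by the centre.
    It may fail once the star is full and Staller plays elsewhere, but Dominator's share is then
    frozen and the coarse bound persists.\<close>
  have inv: "ctr h \<notin> ?D h \<and> (length h \<ge> 2 \<longrightarrow> ctr h \<in> ?S h) \<and>
      card (L h \<inter> ?D h) \<le> b * (card (L h \<inter> ?S h) + 2) \<and>
      (\<not> L h \<subseteq> claimed h \<longrightarrow> card (L h \<inter> ?D h) \<le>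
        b * (card (L h \<inter> ?S h) + of_bool (odd (length h)) + of_bool (length h \<ge> 2)))"
    if "legal_history b ?T h" "follows Staller \<sigma> h" "h \<noteq> []" for h
    using that
  proof (induction rule: legal_history.induct)
    case start
    then show ?case by simp
  next
    case (turn h M)
    have fin: "finite (L h)" for h
      by (simp add: L_def finite_star_leaves)
    show ?case
    proof (cases "h = []")
      case True
      have "card M \<le> b" "finite M"
        using turn.hyps(2) True
        finite_move[of M "claimed h"] by (auto simp: legal_move_def to_move_def)
      then have "card (L [M] \<inter> M) \<le> b"
        using card_mono[of M "L [M] \<inter> M"] by simp
      then show ?thesis
        using True ctr(2)[of "[M]"] \<open>card M \<le> b\<close> \<open>finite M\<close> claimed_by_snoc[of _ "[]" M]
        by (auto simp: to_move_def)
    next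
      case False
      have c: "ctr (h @ [M]) = ctr h" and L: "L (h @ [M]) = L h"
        using ctr_snoc[OF False] by (simp_all add: L_def)
      have M: "M \<subseteq> pverts ?T - claimed h"
        using turn.hyps(2) by (simp add: legal_move_def)
      note IH = turn.IH[OF _ False]
      have len: "length h \<ge> 1" using False by (cases h) auto
      show ?thesis
      proof (cases "to_move h")
        case Dominator
        then have "even (length h)" by (auto simp: to_move_def split: if_splits)
        with len have "length h \<ge> 2" by (cases "length h = 1") auto
        have IH': "ctr h \<notin> ?D h" "ctr h \<in> ?S h"
          "card (L h \<inter> ?D h) \<le> b * (card (L h \<inter> ?S h) + 2)"
          "\<not> L h \<subseteq> claimed h \<Longrightarrow> card (L h \<inter> ?D h) \<le> b * (card (L h \<inter> ?S h) + 1)"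
          using IH turn.prems \<open>length h \<ge> 2\<close> \<open>even (length h)\<close> by auto
        have "ctr h \<notin> M" using M IH'(2) by (auto simp: claimed_eq)
        moreover have "card (L h \<inter> (?D h \<union> M)) \<le> b * (card (L h \<inter> ?S h) + 2)"
        proof (cases "L h \<subseteq> claimed h")
          case True
          then have "L h \<inter> (?D h \<union> M) = L h \<inter> ?D h" using M by auto
          with IH'(3) show ?thesis by simp
        next
          case False
          have "card M \<le> b"
            using turn.hyps(2) Dominator by (simp add: legal_move_def)
          moreover have "finite M"
            using M by (auto intro: finite_subset)
          then have "card (L h \<inter> M) \<le> card M"
            by (simp add: card_mono)
          moreover have "card (L h \<inter> (?D h \<union> M)) \<le> card (L h \<inter> ?D h) + card (L h \<inter> M)"
            by (metis Int_Un_distrib card_Un_le)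
          ultimately show ?thesis
            using IH'(4)[OF False] by simp
        qed
        ultimately show ?thesis
          using IH'(1,2) Dominator \<open>length h \<ge> 2\<close> \<open>even (length h)\<close> c L by simp
      next
        case Staller
        then have odd: "odd (length h)" by (auto simp: to_move_def split: if_splits)
        obtain v where v: "M = {v}" "v \<in> target h" "v \<in> pverts ?T - claimed h"
          using \<sigma>[OF turn.hyps(1) _ False] turn.hyps(2) turn.prems Staller
          by (auto simp: legal_move_def)
        have ctr_S: "ctr h \<in> insert v (?S h)"
        proof (cases "ctr h \<in> claimed h")
          case True
          then show ?thesis using IH turn.prems by (auto simp: claimed_eq)
        next
          case False
          then show ?thesis using v(2) by (simp add: target_def)
        qed
        have le: "card (L h \<inter> ?S h) \<le> card (L h \<inter> insert v (?S h))"
          using fin by (intro card_mono) auto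
        have bound: "card (L h \<inter> ?D h) \<le> b * (card (L h \<inter> insert v (?S h)) + 2)"
        proof -
          have "card (L h \<inter> ?D h) \<le> b * (card (L h \<inter> ?S h) + 2)"
            using IH turn.prems by simp
          also have "\<dots> \<le> b * (card (L h \<inter> insert v (?S h)) + 2)"
            using le by (intro mult_le_mono2) simp
          finally show ?thesis .
        qed
        have "card (L h \<inter> ?D h) \<le> b * (card (L h \<inter> insert v (?S h)) + 1)"
          if nL: "\<not> L h \<subseteq> insert v (claimed h)"
        proof (cases "length h \<ge> 2")
          case True
          then have "ctr h \<in> claimed h"
            using IH turn.prems by (auto simp: claimed_eq)
          then have "v \<in> L h - claimed h"
            using v(2) nL by (auto simp: target_def split: if_splits)
          then have "L h \<inter> insert v (?S h) = insert v (L h \<inter> ?S h)" "v \<notin> L h \<inter> ?S h"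
            by (auto simp: claimed_eq)
          then have "card (L h \<inter> insert v (?S h)) = card (L h \<inter> ?S h) + 1"
            using fin by simp
          then show ?thesis
            using IH turn.prems nL True odd by auto
        next
          \<comment> \<open>Staller's first turn gains no leaf, but the allowance for odd length is
            replaced by the one for length at least 2.\<close>
          case False
          then have "card (L h \<inter> ?D h) \<le> b * (card (L h \<inter> ?S h) + 1)"
            using IH turn.prems nL odd by auto
          also have "\<dots> \<le> b * (card (L h \<inter> insert v (?S h)) + 1)"
            using le by (intro mult_le_mono2) simp
          finally show ?thesis .
        qed
        moreover have "ctr h \<notin> ?D h"
          using IH turn.prems by simp
        moreover have "?S (h @ [M]) = insert v (?S h)" "?D (h @ [M]) = ?D h"
          "claimed (h @ [M]) = insert v (claimed h)"
          using Staller v(1) by simp_all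
        moreover have "even (length (h @ [M]))" "length (h @ [M]) \<ge> 2"
          using odd len by simp_all
        ultimately show ?thesis
          using ctr_S bound by (simp only: c L) simp
      qed
    qed
  qed
  have outcome: "\<exists>s. card (dominated ?T h) + s \<le> (b + 1) * (m + 1) \<and> m \<le> (b + 1) * s + 2 * b"
    if h: "legal_history b ?T h" "game_over ?T h" "follows Staller \<sigma> h" for h
  proof -
    have claimed: "claimed h = {..<(b + 1) * (m + 1)}"
      using h(2) by (simp add: game_over_def)
    have "h \<noteq> []"
      using claimed by (auto simp: claimed_def)
    have c: "ctr h \<le> b"
      using ctr first[OF h(1) \<open>h \<noteq> []\<close>] by simp
    have inv: "ctr h \<notin> ?D h" "card (L h \<inter> ?D h) \<le> b * (card (L h \<inter> ?S h) + 2)"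
      using inv[OF h(1,3) \<open>h \<noteq> []\<close>] by simp_all
    define s where "s = card (L h \<inter> ?S h)"
    have "L h = (L h \<inter> ?D h) \<union> (L h \<inter> ?S h)"
      using L_verts[of h] claimed claimed_eq[of h] by auto
    then have "m \<le> card (L h \<inter> ?D h) + s"
      unfolding s_def using card_star_leaves[OF c, of m]
      by (metis L_def card_Un_le)
    with inv(2) have "m \<le> (b + 1) * s + 2 * b"
      by (simp add: s_def)
    moreover have "v \<notin> dominated ?T h" if "v \<in> L h \<inter> ?S h" for v
      using that inv(1) claimed_by_disjoint[OF h(1)] leaf_neighbour[of v b m "ctr h"]
      by (auto simp: dominated_def L_def)
    then have "dominated ?T h \<inter> (L h \<inter> ?S h) = {}" by auto
    moreover have "finite (dominated ?T h)" "finite (L h \<inter> ?S h)"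
      by (auto simp: dominated_def L_def finite_star_leaves)
    ultimately have "card (dominated ?T h) + s = card (dominated ?T h \<union> (L h \<inter> ?S h))"
      by (simp add: s_def card_Un_disjoint)
    also have "\<dots> \<le> card (pverts ?T)"
      using L_verts[of h] by (intro card_mono) (auto simp: dominated_def)
    finally show ?thesis
      using \<open>m \<le> (b + 1) * s + 2 * b\<close> by auto
  qed
  show ?thesis
    by (rule can_ensureI[OF strat]) (rule outcome)
qed

section \<open>Asymptotic sharpness\<close>

text \<open>With N leaves per star there are n = (b + 1) * (N + 1) vertices, so n / (b + 1)^2 = (N +
  1) / (b + 1). Staller falls short of that many undominated vertices by at most 2, hence the error
  2 / n.\<close>

theorem Staller_on_trees:
  "\<exists>\<epsilon> :: nat \<Rightarrow> real. \<epsilon> \<longlonglongrightarrow> 0 \<and>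
    (\<forall>N. \<exists>T :: nat pair_pre_digraph. undirected_tree T \<and> card (pverts T) \<ge> N \<and>
       can_ensure b T Staller
         (\<lambda>d. real d \<le> (1 - 1 / (real b + 1)^2 + \<epsilon> (card (pverts T))) * real (card (pverts T))))"
proof (intro exI[of _ "\<lambda>n. 2 / real n"] conjI allI)
  show "(\<lambda>n. 2 / real n) \<longlonglongrightarrow> 0"
    by (rule lim_const_over_n)
next
  fix N
  let ?T = "joined_stars b N" and ?n = "(b + 1) * (N + 1)"
  define r where "r = real ?n"
  have r: "r = (real b + 1) * (real N + 1)"
    by (simp add: r_def algebra_simps)
  then have "r \<noteq> 0"
    by (simp add: add_pos_nonneg)
  have bound: "real d \<le> (1 - 1 / (real b + 1)^2 + 2 / r) * r"
    if "d + s \<le> ?n" "N \<le> (b + 1) * s + 2 * b" for d s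
  proof -
    have "real N \<le> real ((b + 1) * s + 2 * b)"
      using that(2) by (simp only: of_nat_le_iff)
    \<comment> \<open>Here 2 * b + 1 is rounded up to 2 * (b + 1), the source of the constant
      2.\<close>
    then have "real N + 1 \<le> (real s + 2) * (real b + 1)"
      by (simp add: algebra_simps)
    then have "(real N + 1) / (real b + 1) \<le> real s + 2"
      by (simp add: pos_divide_le_eq)
    moreover have "r / (real b + 1)^2 = (real N + 1) / (real b + 1)"
      unfolding r by (simp only: power2_eq_square) simp
    moreover have "(1 - 1 / (real b + 1)^2 + 2 / r) * r = r - r / (real b + 1)^2 + 2"
      using \<open>r \<noteq> 0\<close> by (simp only: ring_distribs) simp
    moreover have "real (d + s) \<le> r"
      unfolding r_def using that(1) by (simp only: of_nat_le_iff)
    then have "real d + real s \<le> r"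
      by simp
    ultimately show ?thesis
      by linarith
  qed
  have "can_ensure b ?T Staller
      (\<lambda>d. real d \<le> (1 - 1 / (real b + 1)^2 + 2 / real (card (pverts ?T))) * real (card (pverts ?T)))"
    by (rule can_ensure_mono[OF Staller_on_joined_stars])
      (use bound in \<open>auto simp: r_def simp del: of_nat_mult of_nat_add mult_Suc mult_Suc_right\<close>)
  moreover have "card (pverts ?T) \<ge> N" by simp
  ultimately show "\<exists>T :: nat pair_pre_digraph. undirected_tree T \<and> card (pverts T) \<ge> N \<and>
       can_ensure b T Staller
         (\<lambda>d. real d \<le> (1 - 1 / (real b + 1)^2 + 2 / real (card (pverts T))) * real (card (pverts T)))"
    using undirected_tree_joined_stars by blast
qed

theorem theorem1p6:
  fixes b :: nat
  assumes "b > 0"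
  shows
    "(\<forall>T :: 'a pair_pre_digraph. undirected_tree T \<longrightarrow>
        can_ensure b T Dominator
          (\<lambda>d. real d \<ge> (1 - 1 / (real b + 1)^2) * real (card (pverts T))))
     \<and>
     (\<exists>\<epsilon> :: nat \<Rightarrow> real. \<epsilon> \<longlonglongrightarrow> 0 \<and>
        (\<forall>N. \<exists>T :: nat pair_pre_digraph. undirected_tree T \<and> card (pverts T) \<ge> N \<and>
           can_ensure b T Staller
             (\<lambda>d. real d \<le> (1 - 1 / (real b + 1)^2 + \<epsilon> (card (pverts T)))
                            * real (card (pverts T)))))"
  using Dominator_on_trees[OF assms] Staller_on_trees[of b] by blast

end
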